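(* Let $A$ be a closed, densely defined linear (possibly unbounded) operator in a Hilbert space $H$ with null space $N$, and let $T=A^*A$, $T_a=T+aI$ for $a>0$. Let $f=Ay$, where $y$ is in the domain of $A$ and $y\perp N$. Let $a:[0,\infty)\to(0,\infty)$ be a monotonically decaying twice continuously differentiable function such that $$\lim_{t\to\infty}\bigl[a(t)+|\dot a(t)|+\ddot a(t)\bigr]=0,\qquad \ddot a(t)>0,\qquad \lim_{t\to\infty}\frac{\dot a(t)}{a(t)}=0 .$$ Let $C$ be a constant with $1<C<2$, and for small $\delta>0$ let $f_\delta\in H$ satisfy $\|f_\delta-f\|\le\delta$ and $\|f_\delta\|>C\delta$. Let $u_\delta(t)$, $t\ge0$, be the solution of $$\dot u_\delta=-u_\delta+T_{a(t)}^{-1}A^*f_\delta,\qquad u_\delta(0)=0 .$$ Then, for all sufficiently small $\delta>0$, the equation $$\|AT_{a(t)}^{-1}A^*f_\delta-f_\delta\|=C\delta$$ has a solution $t=t_\delta$, with $\lim_{\delta\to0}t_\delta=\infty$, such that $$\lim_{\delta\to0}\|u_\delta(t_\delta)-y\|=0 .$$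
   Context: $N=N(A)=\{u: Au=0\}$; $A^*$ is the adjoint of $A$; $T=A^*A\ge0$ is selfadjoint; $I$ is the identity; dots denote $d/dt$. For constant $a>0$, the operator $T_a^{-1}A^*$ with domain $D(A^* )$ is closable and its closure, again denoted $T_a^{-1}A^*$, is a bounded operator defined on all of $H$ with $\|T_a^{-1}A^*\|\le \frac{1}{2\sqrt a}$; it equals $A^*Q_a^{-1}$, where $Q=AA^*$ and $Q_a=Q+aI$, so $AT_a^{-1}A^*=QQ_a^{-1}$ is a bounded operator on $H$. The notation $T_{a(t)}^{-1}A^*f_\delta$ refers to this closure. *)

theory Defs
  imports "HOL-Analysis.Analysis"
begin

text \<open>
  The scalar field of a Hilbert space. The axioms leave only two models: a real normed field is
  isomorphic to the reals or to the complex numbers, and the last axiom forces the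
  conjugation to be the identity in the first case and complex conjugation in the second.
\<close>

class real_or_complex_field = real_normed_field +
  fixes scalar_conj :: "'a \<Rightarrow> 'a"
  assumes scalar_conj_add: "scalar_conj (x + y) = scalar_conj x + scalar_conj y"
    and scalar_conj_mult: "scalar_conj (x * y) = scalar_conj x * scalar_conj y"
    and scalar_conj_scaleR: "scalar_conj (r *\<^sub>R x) = r *\<^sub>R scalar_conj x"
    and mult_conj: "x * scalar_conj x = (norm x)\<^sup>2 *\<^sub>R 1"

instantiation real :: real_or_complex_field
begin
definition scalar_conj_real :: "real \<Rightarrow> real" where "scalar_conj_real x = x"
instance by standard (simp_all add: scalar_conj_real_def power2_eq_square)
end

instantiation complex :: real_or_complex_field
begin
definition scalar_conj_complex :: "complex \<Rightarrow> complex" where "scalar_conj_complex = cnj"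
instance
  by standard
    (simp_all add: scalar_conj_complex_def scaleR_conv_of_real complex_norm_square del: of_real_power)
end

text \<open>
  A Hilbert space over the field \<open>'k\<close>. Norm, topology and completeness come from the type
  classes of \<open>'a\<close>; the class operation \<open>inner\<close> is the real part of \<open>ip\<close>. The
  form \<open>ip\<close> is linear in its first argument.
\<close>

locale hilbert_space = vector_space scal
  for scal :: "'k::real_or_complex_field \<Rightarrow> 'a::{real_inner, complete_space} \<Rightarrow> 'a" +
  fixes ip :: "'a \<Rightarrow> 'a \<Rightarrow> 'k"
  assumes scale_of_real: "scal (of_real r) x = r *\<^sub>R x"
    and ip_add_left: "ip (x + y) z = ip x z + ip y z"
    and ip_scale_left: "ip (scal c x) y = c * ip x y"
    and ip_commute: "ip x y = scalar_conj (ip y x)"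
    and ip_self: "ip x x = of_real (inner x x)"

lemma hilbert_space_real:
  "hilbert_space scaleR (inner :: 'a::{real_inner, complete_space} \<Rightarrow> 'a \<Rightarrow> real)"
  by unfold_locales
    (simp_all add: scalar_conj_real_def algebra_simps inner_commute)

lemma hilbert_space_complex:
  "hilbert_space (*) (\<lambda>x y :: complex. x * cnj y)"
  by unfold_locales
    (simp_all add: scalar_conj_complex_def algebra_simps scaleR_conv_of_real
      complex_norm_square dot_square_norm del: of_real_power)

text \<open>
  A possibly unbounded operator is represented by its graph. Hence
  \<open>Domain A\<close> is its domain, \<open>converse\<close> its inverse, \<open>closed A\<close> says that
  the operator is closed, \<open>closure A\<close> is the graph of its closure, and \<open>B O A\<close> is
  the product in which \<open>B\<close> is applied first, with its natural domain.
\<close>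

definition linear_operator ::
    "('k::real_or_complex_field \<Rightarrow> 'a \<Rightarrow> 'a) \<Rightarrow> ('a \<times> 'a::real_inner) set \<Rightarrow> bool" where
  "linear_operator scal A \<longleftrightarrow>
     single_valued A \<and> (0, 0) \<in> A \<and>
     (\<forall>x z x' z'. (x, z) \<in> A \<longrightarrow> (x', z') \<in> A \<longrightarrow> (x + x', z + z') \<in> A) \<and>
     (\<forall>c x z. (x, z) \<in> A \<longrightarrow> (scal c x, scal c z) \<in> A)"

definition densely_defined :: "('a \<times> 'a::real_inner) set \<Rightarrow> bool" where
  "densely_defined A \<longleftrightarrow> closure (Domain A) = UNIV"

definition op_app :: "('a \<times> 'a) set \<Rightarrow> 'a \<Rightarrow> 'a" where
  "op_app A x = (THE z. (x, z) \<in> A)"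

definition null_space :: "('a \<times> 'a::real_inner) set \<Rightarrow> 'a set" where
  "null_space A = {u. (u, 0) \<in> A}"

definition adjoint_op ::
    "('a \<Rightarrow> 'a \<Rightarrow> 'k) \<Rightarrow> ('a \<times> 'a::real_inner) set \<Rightarrow> ('a \<times> 'a) set" where
  "adjoint_op ip A = {(v, w). \<forall>(x, z) \<in> A. ip z v = ip x w}"

definition gram_op ::
    "('a \<Rightarrow> 'a \<Rightarrow> 'k) \<Rightarrow> ('a \<times> 'a::real_inner) set \<Rightarrow> ('a \<times> 'a) set" where
  "gram_op ip A = A O adjoint_op ip A"

definition shift_op :: "('a \<times> 'a::real_inner) set \<Rightarrow> real \<Rightarrow> ('a \<times> 'a) set" where
  "shift_op T a = {(x, z + a *\<^sub>R x) | x z. (x, z) \<in> T}"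

text \<open>
  \<open>T\<^sub>a\<inverse> A\<^sup>*\<close> is defined on the domain of \<open>A\<^sup>*\<close> only; its closure is an operator
  defined on the whole space.
\<close>

definition reg_op ::
    "('a \<Rightarrow> 'a \<Rightarrow> 'k) \<Rightarrow> ('a \<times> 'a::real_inner) set \<Rightarrow> real \<Rightarrow> ('a \<times> 'a) set" where
  "reg_op ip A a = closure (adjoint_op ip A O converse (shift_op (gram_op ip A) a))"

end

theory Submission
  imports Defs
begin

text \<open>
  For \<open>a > 0\<close> and any \<open>v\<close>, projecting onto the (rescaled) closed graph of \<open>A\<close> yields a unique \<open>x\<close>
  with \<open>A\<^sup>* (v - A x) = a x\<close>. The map \<open>v \<mapsto> x\<close> is bounded by \<open>1 / (2 sqrt a)\<close> and is the closure of
  \<open>T\<^sub>a\<inverse> A\<^sup>*\<close> (\<open>reg_op_eq_approx_graph\<close>), so the left-hand side of the discrepancy equation is the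
  norm of the residual \<open>r = v - A x\<close>. That norm is continuous and increasing in \<open>a\<close>, and
  \<open>v \<mapsto> r\<close> is a contraction.

  For exact data \<open>f = A y\<close>, the error \<open>e = y - x\<close> and the residual \<open>r\<close> satisfy
  \<open>\<parallel>e\<parallel>\<^sup>2 + \<parallel>r\<parallel>\<^sup>2 / a = \<langle>e, y\<rangle>\<close> (\<open>exact_data_identity\<close>). Since \<open>y\<close> is orthogonal to the null space, it
  is a limit of vectors in the range of \<open>A\<^sup>*\<close>, which gives \<open>e \<rightarrow> 0\<close> as \<open>a \<rightarrow> 0\<close>; then the identity gives
  \<open>\<parallel>r\<parallel> = o(sqrt a)\<close>.

  If \<open>f\<close> were zero, the conditions on \<open>f\<^sub>\<delta>\<close> would contradict \<open>C > 1\<close>; so the residual of \<open>f\<close>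
  is positive at each time. It follows that the residual of \<open>f\<^sub>\<delta>\<close> exceeds \<open>C \<delta>\<close> on any given bounded
  time interval once \<open>\<delta>\<close> is small. For fixed \<open>\<delta>\<close> it finally drops below \<open>C \<delta>\<close>, because the noise
  contributes at most \<open>\<delta> < C \<delta>\<close>. The intermediate value theorem yields \<open>t\<^sub>\<delta>\<close>, and
  \<open>t\<^sub>\<delta> \<rightarrow> \<infinity>\<close>. At \<open>t\<^sub>\<delta>\<close> the exact residual is at least \<open>(C - 1) \<delta>\<close>, so \<open>\<delta> = o(sqrt (a t\<^sub>\<delta>))\<close>.

  Since \<open>a\<close> decreases, the noise moves \<open>T\<^sub>a\<inverse> A\<^sup>* f\<^sub>\<delta>\<close>, at all times up to \<open>t\<^sub>\<delta>\<close>, by at most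
  \<open>\<delta> / (2 sqrt (a t\<^sub>\<delta>)) \<rightarrow> 0\<close>. The driving term of the evolution equation is therefore close to \<open>y\<close>
  except on an initial interval, where it is bounded; and the equation forgets that interval
  exponentially fast (\<open>relaxation_bound\<close>).
\<close>

section \<open>Orthogonal projections\<close>

text \<open>
  A minimizing sequence is Cauchy by the parallelogram law, and its limit minimizes the distance;
  varying the minimizer along \<open>s\<close> gives orthogonality.
\<close>

lemma orthogonal_projection_exists:
  fixes S :: "'b::{real_inner, complete_space} set"
  assumes "subspace S" and "closed S"
  obtains p where "p \<in> S" and "\<And>s. s \<in> S \<Longrightarrow> inner (x - p) s = 0"
proof -
  define D where "D = (INF s\<in>S. (norm (x - s))\<^sup>2)"
  have bdd: "bdd_below ((\<lambda>s. (norm (x - s))\<^sup>2) ` S)"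
    by (rule bdd_belowI2[of _ 0]) simp
  have D_le: "D \<le> (norm (x - s))\<^sup>2" if "s \<in> S" for s
    unfolding D_def using bdd that by (rule cINF_lower)
  have S_nonempty: "S \<noteq> {}" using subspace_0[OF assms(1)] by blast
  have "\<exists>s\<in>S. (norm (x - s))\<^sup>2 < D + inverse (Suc n)" for n :: nat
  proof -
    have "(INF s\<in>S. (norm (x - s))\<^sup>2) < D + inverse (Suc n)"
      unfolding D_def by simp
    then show ?thesis using cINF_less_iff[OF S_nonempty bdd] by blast
  qed
  then obtain p where p: "\<And>n. p n \<in> S"
      "\<And>n. (norm (x - p n))\<^sup>2 < D + inverse (real (Suc n))"
    by metis
  have close: "(norm (p m - p n))\<^sup>2 \<le> 2 * inverse (real (Suc m)) + 2 * inverse (real (Suc n))" for m n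
  proof -
    have "(1/2) *\<^sub>R (p m + p n) \<in> S"
      using p(1) assms(1) by (intro subspace_scale subspace_add) auto
    then have "D \<le> (norm (x - (1/2) *\<^sub>R (p m + p n)))\<^sup>2" by (rule D_le)
    moreover have "(norm (p m - p n))\<^sup>2 = 2 * (norm (x - p m))\<^sup>2 + 2 * (norm (x - p n))\<^sup>2
        - 4 * (norm (x - (1/2) *\<^sub>R (p m + p n)))\<^sup>2"
      unfolding power2_norm_eq_inner by (simp add: inner_simps inner_commute algebra_simps)
    ultimately show ?thesis using p(2)[of m] p(2)[of n] by linarith
  qed
  have "Cauchy p"
  proof (rule metric_CauchyI)
    fix e :: real assume "e > 0"
    then obtain N where N: "inverse (real (Suc N)) < e\<^sup>2 / 4"
      using reals_Archimedean[of "e\<^sup>2 / 4"] by auto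
    have "dist (p m) (p n) < e" if "m \<ge> N" "n \<ge> N" for m n
    proof -
      have "inverse (real (Suc m)) \<le> inverse (real (Suc N))"
        "inverse (real (Suc n)) \<le> inverse (real (Suc N))"
        using that by (auto intro!: le_imp_inverse_le)
      then have "(norm (p m - p n))\<^sup>2 < e\<^sup>2"
        using close[of m n] N by linarith
      then show ?thesis using \<open>e > 0\<close> by (simp add: dist_norm power_less_imp_less_base)
    qed
    then show "\<exists>M. \<forall>m\<ge>M. \<forall>n\<ge>M. dist (p m) (p n) < e" by blast
  qed
  then obtain q where q: "p \<longlonglongrightarrow> q" using Cauchy_convergent_iff convergent_def by blast
  have "q \<in> S" using closed_sequentially[OF assms(2)] p(1) q by blast
  have "(\<lambda>n. D + inverse (real (Suc n))) \<longlonglongrightarrow> D + 0"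
    by (intro tendsto_intros LIMSEQ_inverse_real_of_nat)
  moreover have "(\<lambda>n. (norm (x - p n))\<^sup>2) \<longlonglongrightarrow> (norm (x - q))\<^sup>2"
    by (intro tendsto_intros q)
  ultimately have q_le: "(norm (x - q))\<^sup>2 \<le> D"
    using p(2) by (intro LIMSEQ_le) (auto intro: less_imp_le)
  have "inner (x - q) s = 0" if "s \<in> S" for s
  proof (cases "s = 0")
    case False
    define c where "c = inner (x - q) s"
    \<comment> \<open>the minimizer of the quadratic polynomial \<open>norm (x - q - t s)\<^sup>2\<close> in \<open>t\<close>\<close>
    define t where "t = c / inner s s"
    have s: "inner s s > 0" using False by simp
    have "q + t *\<^sub>R s \<in> S"
      using \<open>q \<in> S\<close> that assms(1) by (intro subspace_scale subspace_add) auto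
    then have "(norm (x - q))\<^sup>2 \<le> (norm (x - (q + t *\<^sub>R s)))\<^sup>2"
      using D_le q_le order_trans by blast
    also have "\<dots> = (norm (x - q))\<^sup>2 - 2 * t * c + t\<^sup>2 * inner s s"
      unfolding power2_norm_eq_inner c_def
      by (simp add: inner_simps inner_commute algebra_simps power2_eq_square)
    also have "t\<^sup>2 * inner s s = t * c"
      using s by (simp add: t_def power2_eq_square)
    finally have "t * c \<le> 0" by (simp add: mult.commute)
    then have "c\<^sup>2 / inner s s \<le> 0" by (simp add: t_def power2_eq_square)
    then have "c\<^sup>2 \<le> 0" using s by (simp add: divide_le_0_iff)
    then show ?thesis by (simp add: c_def)
  qed simp
  with \<open>q \<in> S\<close> show thesis by (rule that)
qed

lemma closure_of_subspace:
  fixes S :: "'b::real_normed_vector set"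
  assumes "subspace S"
  shows "subspace (closure S)" "closed (closure S)"
proof -
  have "x + y \<in> closure S" if "x \<in> closure S" "y \<in> closure S" for x y
  proof -
    obtain p q where "\<And>n. p n \<in> S" "p \<longlonglongrightarrow> x" "\<And>n. q n \<in> S" "q \<longlonglongrightarrow> y"
      using \<open>x \<in> closure S\<close> \<open>y \<in> closure S\<close> unfolding closure_sequential by blast
    then have "\<And>n. p n + q n \<in> S" "(\<lambda>n. p n + q n) \<longlonglongrightarrow> x + y"
      using assms by (auto intro: subspace_add tendsto_add)
    then show ?thesis unfolding closure_sequential by (intro exI[of _ "\<lambda>n. p n + q n"]) blast
  qed
  moreover have "c *\<^sub>R x \<in> closure S" if "x \<in> closure S" for c x
  proof -
    obtain p where "\<And>n. p n \<in> S" "p \<longlonglongrightarrow> x"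
      using \<open>x \<in> closure S\<close> unfolding closure_sequential by auto
    then have "\<And>n. c *\<^sub>R p n \<in> S" "(\<lambda>n. c *\<^sub>R p n) \<longlonglongrightarrow> c *\<^sub>R x"
      using assms by (auto intro: subspace_scale tendsto_scaleR)
    then show ?thesis unfolding closure_sequential by (intro exI[of _ "\<lambda>n. c *\<^sub>R p n"]) blast
  qed
  moreover have "0 \<in> closure S" using subspace_0[OF assms] closure_subset by blast
  ultimately show "subspace (closure S)" by (simp add: subspace_def)
qed simp

lemma orthogonal_to_closure:
  fixes y :: "'b::real_inner"
  assumes "\<And>s. s \<in> S \<Longrightarrow> inner y s = 0" and "p \<in> closure S"
  shows "inner y p = 0"
proof -
  have "closed {s. inner y s = 0}"
    by (intro closed_Collect_eq continuous_intros)
  then have "closure S \<subseteq> {s. inner y s = 0}"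
    using assms(1) by (intro closure_minimal) auto
  then show ?thesis using assms(2) by blast
qed

section \<open>Reduction to the real inner product\<close>

lemma scalar_conj_one [simp]: "scalar_conj (1 :: 'k::real_or_complex_field) = 1"
  using mult_conj[of "1 :: 'k"] by simp

lemma scalar_conj_diff:
  "scalar_conj (x - y) = scalar_conj x - scalar_conj (y :: 'k::real_or_complex_field)"
  using scalar_conj_add[of "x - y" y] by (simp add: algebra_simps)

context hilbert_space
begin

lemma ip_add_right: "ip x (y + z) = ip x y + ip x z"
  by (metis ip_add_left ip_commute scalar_conj_add)

lemma ip_polarization: "ip x y + ip y x = of_real (2 * inner x y)"
proof -
  have "ip (x + y) (x + y) = ip x x + ip y y + (ip x y + ip y x)"
    by (simp add: ip_add_left ip_add_right algebra_simps)
  moreover have "ip (x + y) (x + y) = ip x x + ip y y + of_real (2 * inner x y)"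
    by (simp add: ip_self inner_simps inner_commute)
  ultimately show ?thesis by simp
qed

lemma ip_zero_imp_inner_zero: "ip x y = 0 \<Longrightarrow> inner x y = 0"
proof -
  assume "ip x y = 0"
  moreover from this have "ip y x = 0"
    using ip_commute[of y x] scalar_conj_diff[of 0 "0::'k"] by simp
  ultimately have "of_real (2 * inner x y) = (0 :: 'k)" using ip_polarization[of x y] by simp
  then show ?thesis by (simp only: of_real_eq_0_iff mult_eq_0_iff) simp
qed

lemma linear_operator_imp_subspace: "linear_operator scal A \<Longrightarrow> real_vector.subspace A"
  unfolding linear_operator_def real_vector.subspace_def by (auto simp flip: scale_of_real simp: zero_prod_def)

text \<open>
  The real part of a scalar \<open>c\<close> is all that \<open>inner\<close> sees. Since the graph is invariant under
  multiplication by \<open>scalar_conj c\<close>, where \<open>c\<close> is the defect in the adjoint identity, that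
  identity for \<open>inner\<close> already gives \<open>norm c = 0\<close>.
\<close>

lemma adjoint_op_eq_real_adjoint:
  assumes "linear_operator scal A"
  shows "adjoint_op ip A = adjoint_op inner A"
proof -
  have "ip z v = ip x w"
    if inner_eq: "\<forall>(x, z)\<in>A. inner z v = inner x w" and xz: "(x, z) \<in> A" for v w x z
  proof -
    define c where "c = ip z v - ip x w"
    define d where "d = scalar_conj c"
    have "(scal d x, scal d z) \<in> A" using assms xz unfolding linear_operator_def by blast
    then have "inner (scal d z) v = inner (scal d x) w" using inner_eq by blast
    then have "ip (scal d z) v + ip v (scal d z) = ip (scal d x) w + ip w (scal d x)"
      by (simp only: ip_polarization)
    then have "(ip (scal d z) v - ip (scal d x) w)
        + scalar_conj (ip (scal d z) v - ip (scal d x) w) = 0"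
      using ip_commute[of v "scal d z"] ip_commute[of w "scal d x"]
      by (simp add: scalar_conj_diff algebra_simps)
    moreover have "ip (scal d z) v - ip (scal d x) w = (norm c)\<^sup>2 *\<^sub>R 1"
      using mult_conj[of c] by (simp add: ip_scale_left c_def d_def algebra_simps)
    ultimately have "((norm c)\<^sup>2 + (norm c)\<^sup>2) *\<^sub>R (1 :: 'k) = 0"
      by (simp only: scalar_conj_scaleR scalar_conj_one scaleR_add_left)
    then have "c = 0" by (simp only: scaleR_eq_0_iff) simp
    then show ?thesis by (simp add: c_def)
  qed
  moreover have "inner z v = inner x w" if "ip z v = ip x w" for x z v w
  proof -
    have "ip v z = ip w x" using that ip_commute by metis
    then have "of_real (2 * inner z v) = (of_real (2 * inner x w) :: 'k)"
      using that by (simp only: ip_polarization [symmetric])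
    then show ?thesis by simp
  qed
  ultimately show ?thesis unfolding adjoint_op_def by blast
qed

end

section \<open>Closed densely defined operators\<close>

locale closed_dense_operator =
  fixes A :: "('a::{real_inner, complete_space} \<times> 'a) set"
  assumes graph_subspace: "subspace A"
    and graph_closed: "closed A"
    and graph_single_valued: "single_valued A"
    and domain_dense: "closure (Domain A) = UNIV"
begin

abbreviation adj :: "('a \<times> 'a) set" where "adj \<equiv> adjoint_op inner A"

lemma graph_diff: "(x, z) \<in> A \<Longrightarrow> (x', z') \<in> A \<Longrightarrow> (x - x', z - z') \<in> A"
  using subspace_diff[OF graph_subspace, of "(x, z)" "(x', z')"] by simp

lemma op_app_eq: "(x, z) \<in> A \<Longrightarrow> op_app A x = z"
  unfolding op_app_def using graph_single_valued by (auto simp: single_valued_def)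

lemma graph_zero: "(0, z) \<in> A \<Longrightarrow> z = 0"
  using subspace_0[OF graph_subspace] graph_single_valued
  by (auto simp: single_valued_def zero_prod_def)

lemma adjD: "(x, z) \<in> A \<Longrightarrow> (v, w) \<in> adj \<Longrightarrow> inner z v = inner x w"
  unfolding adjoint_op_def by blast

lemma adj_diff: "(v, w) \<in> adj \<Longrightarrow> (v', w') \<in> adj \<Longrightarrow> (v - v', w - w') \<in> adj"
  unfolding adjoint_op_def by (fastforce simp: inner_diff_right)

lemma adj_subspace: "subspace adj"
  unfolding subspace_def adjoint_op_def
  by (fastforce simp: zero_prod_def inner_simps)

lemma adj_domain_subspace: "subspace (Domain adj)"
proof -
  have "Domain adj = fst ` adj" by force
  then show ?thesis using linear_subspace_image[OF linear_fst adj_subspace] by simp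
qed

lemma adj_range_subspace: "subspace (Range adj)"
proof -
  have "Range adj = snd ` adj" by force
  then show ?thesis using linear_subspace_image[OF linear_snd adj_subspace] by simp
qed

lemma adj_zero: "(0, w) \<in> adj \<Longrightarrow> w = 0"
proof -
  assume "(0, w) \<in> adj"
  then have "inner w x = 0" if "x \<in> Domain A" for x
    using that adjD by (fastforce simp: inner_commute)
  moreover have "w \<in> closure (Domain A)" by (simp add: domain_dense)
  ultimately have "inner w w = 0" by (rule orthogonal_to_closure)
  then show ?thesis by simp
qed

text \<open>
  This is \<open>A\<^sup>*\<^sup>* \<subseteq> A\<close>: the orthogonal complement of the graph of \<open>A\<close> is, up to a rotation, the
  graph of the adjoint. So the component of \<open>(u, v)\<close> orthogonal to \<open>A\<close> can be tested against
  the hypothesis, which makes it vanish.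
\<close>

lemma double_adjoint_subset:
  assumes "\<And>p q. (p, q) \<in> adj \<Longrightarrow> inner u q = inner v p"
  shows "(u, v) \<in> A"
proof -
  obtain P where P: "P \<in> A" "\<And>s. s \<in> A \<Longrightarrow> inner ((u, v) - P) s = 0"
    using orthogonal_projection_exists[OF graph_subspace graph_closed, of "(u, v)"] by metis
  obtain x z where xz: "P = (x, z)" by (cases P)
  have "inner (u - x) x' + inner (v - z) z' = 0" if "(x', z') \<in> A" for x' z'
    using P(2)[OF that] by (simp add: xz)
  then have in_adj: "(v - z, x - u) \<in> adj"
    unfolding adjoint_op_def by (auto simp: inner_simps inner_commute algebra_simps)
  have "inner u (x - u) = inner v (v - z)" by (rule assms[OF in_adj])
  moreover have "inner z (v - z) = inner x (x - u)" by (rule adjD[OF P(1)[unfolded xz] in_adj])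
  ultimately have "inner (x - u) (x - u) + inner (v - z) (v - z) = 0"
    by (simp add: inner_simps inner_commute)
  then have "x = u" "z = v" by (simp_all add: add_nonneg_eq_0_iff)
  then show ?thesis using P(1) xz by simp
qed

lemma adj_domain_dense: "closure (Domain adj) = UNIV"
proof -
  have "v \<in> closure (Domain adj)" for v
  proof -
    obtain p where p: "p \<in> closure (Domain adj)"
        "\<And>s. s \<in> closure (Domain adj) \<Longrightarrow> inner (v - p) s = 0"
      using orthogonal_projection_exists[OF closure_of_subspace[OF adj_domain_subspace], of v] by metis
    have "inner (v - p) s = 0" if "s \<in> Domain adj" for s
      by (rule p(2)[OF subsetD[OF closure_subset that]])
    then have "(0, v - p) \<in> A" by (intro double_adjoint_subset) auto
    then have "v = p" using graph_zero by force
    then show ?thesis using p(1) by simp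
  qed
  then show ?thesis by blast
qed

lemma orthogonal_null_space_imp_closure_range_adj:
  assumes "\<And>n. n \<in> null_space A \<Longrightarrow> inner y n = 0"
  shows "y \<in> closure (Range adj)"
proof -
  obtain p where p: "p \<in> closure (Range adj)"
      "\<And>s. s \<in> closure (Range adj) \<Longrightarrow> inner (y - p) s = 0"
    using orthogonal_projection_exists[OF closure_of_subspace[OF adj_range_subspace], of y] by metis
  have "inner (y - p) s = 0" if "s \<in> Range adj" for s
    by (rule p(2)[OF subsetD[OF closure_subset that]])
  then have "(y - p, 0) \<in> A" by (intro double_adjoint_subset) auto
  then have "inner y (y - p) = 0" using assms by (simp add: null_space_def)
  moreover have "inner (y - p) p = 0" using p by blast
  ultimately have "inner (y - p) (y - p) = 0" by (simp add: inner_simps inner_commute)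
  then show ?thesis using p(1) by simp
qed

section \<open>The regularized inverse and its residual\<close>

text \<open>
  \<open>approx a v\<close> is \<open>T\<^sub>a\<inverse> A\<^sup>* v\<close> for arbitrary \<open>v\<close>: the equation \<open>(A\<^sup>* A + a) x = A\<^sup>* v\<close> is written
  as \<open>A\<^sup>* (v - A x) = a x\<close>, which makes sense outside the domain of \<open>A\<^sup>*\<close>.
  It is the Euler equation of the functional \<open>norm (A x - v)\<^sup>2 + a * norm x\<^sup>2\<close>.
\<close>

definition approx :: "real \<Rightarrow> 'a \<Rightarrow> 'a" where
  "approx a v = (THE x. \<exists>z. (x, z) \<in> A \<and> (v - z, a *\<^sub>R x) \<in> adj)"

definition residual :: "real \<Rightarrow> 'a \<Rightarrow> 'a" where
  "residual a v = v - op_app A (approx a v)"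

text \<open>
  Projecting \<open>(0, v)\<close> onto the graph, rescaled by \<open>sqrt a\<close> in its first component, minimizes the
  functional \<open>norm (A x - v)\<^sup>2 + a * norm x\<^sup>2\<close>.
\<close>

lemma approx_exists:
  assumes "a > 0"
  shows "\<exists>x z. (x, z) \<in> A \<and> (v - z, a *\<^sub>R x) \<in> adj"
proof -
  define G where "G = (\<lambda>(x, z). (inverse (sqrt a) *\<^sub>R x, z)) -` A"
  have lin: "linear (\<lambda>(x::'a, z::'a). (inverse (sqrt a) *\<^sub>R x, z))"
    by (rule linearI) (auto simp: algebra_simps)
  have "subspace G"
    unfolding G_def by (rule linear_subspace_vimage[OF lin graph_subspace])
  moreover have "closed G"
    unfolding G_def
    by (intro closed_vimage graph_closed) (auto simp: case_prod_unfold intro!: continuous_intros)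
  ultimately obtain P where P: "P \<in> G" "\<And>s. s \<in> G \<Longrightarrow> inner ((0, v) - P) s = 0"
    using orthogonal_projection_exists[of G "(0, v)"] by metis
  define x z where "x = inverse (sqrt a) *\<^sub>R fst P" and "z = snd P"
  have xz: "(x, z) \<in> A" using P(1) by (simp add: G_def x_def z_def case_prod_unfold)
  have fstP: "fst P = sqrt a *\<^sub>R x" using assms by (simp add: x_def)
  have "inner z' (v - z) = inner x' (a *\<^sub>R x)" if "(x', z') \<in> A" for x' z'
  proof -
    have "(sqrt a *\<^sub>R x', z') \<in> G" using that assms by (simp add: G_def)
    from P(2)[OF this] have "inner (v - z) z' = (sqrt a * sqrt a) * inner x x'"
      by (cases P) (use fstP in \<open>simp add: z_def\<close>)
    then show ?thesis using assms by (simp add: inner_commute)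
  qed
  then show ?thesis using xz unfolding adjoint_op_def by blast
qed

text \<open>Pairing \<open>(x, A x)\<close> with \<open>(v - A x, a x)\<close> gives \<open>norm (A x)\<^sup>2 + a * norm x\<^sup>2 = inner (A x) v\<close>.\<close>

lemma approx_energy:
  assumes "(x, z) \<in> A" and "(v - z, a *\<^sub>R x) \<in> adj"
  shows "(norm z)\<^sup>2 + a * (norm x)\<^sup>2 = inner z v"
  using adjD[OF assms] by (simp add: power2_norm_eq_inner inner_diff_right)

lemma approx_unique:
  assumes "a > 0" and xz: "(x, z) \<in> A" "(v - z, a *\<^sub>R x) \<in> adj"
  shows "approx a v = x"
  unfolding approx_def
proof (rule the_equality)
  fix x' assume "\<exists>z. (x', z) \<in> A \<and> (v - z, a *\<^sub>R x') \<in> adj"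
  then obtain z' where xz': "(x', z') \<in> A" "(v - z', a *\<^sub>R x') \<in> adj" by blast
  have "(x' - x, z' - z) \<in> A" "(0 - (z' - z), a *\<^sub>R (x' - x)) \<in> adj"
    using graph_diff[OF xz'(1) xz(1)] adj_diff[OF xz'(2) xz(2)] by (simp_all add: algebra_simps)
  from approx_energy[OF this] have "(norm (z' - z))\<^sup>2 + a * (norm (x' - x))\<^sup>2 = 0" by simp
  then show "x' = x" using \<open>a > 0\<close> by (simp add: add_nonneg_eq_0_iff)
qed (use xz in blast)

lemma residual_unique:
  assumes "a > 0" and "(x, z) \<in> A" and "(v - z, a *\<^sub>R x) \<in> adj"
  shows "residual a v = v - z"
  using approx_unique[OF assms] op_app_eq[OF assms(2)] by (simp add: residual_def)

lemma approx_graph: "a > 0 \<Longrightarrow> (approx a v, v - residual a v) \<in> A"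
  using approx_exists[of a v] approx_unique residual_unique by fastforce

lemma approx_adj: "a > 0 \<Longrightarrow> (residual a v, a *\<^sub>R approx a v) \<in> adj"
  using approx_exists[of a v] approx_unique residual_unique by fastforce

lemma approx_residual_diff:
  assumes "a > 0"
  shows "approx a (v - w) = approx a v - approx a w"
    and "residual a (v - w) = residual a v - residual a w"
proof -
  let ?x = "approx a v - approx a w" and ?z = "(v - residual a v) - (w - residual a w)"
  have "(?x, ?z) \<in> A" using approx_graph[OF assms] by (intro graph_diff)
  moreover have "((v - w) - ?z, a *\<^sub>R ?x) \<in> adj"
    using adj_diff[OF approx_adj[OF assms, of v] approx_adj[OF assms, of w]]
    by (simp add: algebra_simps)
  ultimately have "approx a (v - w) = ?x" "residual a (v - w) = (v - w) - ?z"
    by (rule approx_unique[OF assms], rule residual_unique[OF assms])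
  then show "approx a (v - w) = ?x" "residual a (v - w) = residual a v - residual a w"
    by (simp_all add: algebra_simps)
qed

lemma approx_norm_le:
  assumes "a > 0"
  shows "norm (approx a v) \<le> norm v / (2 * sqrt a)"
proof -
  let ?z = "v - residual a v"
  have "(norm ?z)\<^sup>2 + a * (norm (approx a v))\<^sup>2 = inner ?z v"
    using approx_graph[OF assms] approx_adj[OF assms] by (intro approx_energy) simp_all
  also have "\<dots> \<le> norm ?z * norm v" by (rule norm_cauchy_schwarz)
  finally have "a * (norm (approx a v))\<^sup>2 \<le> (norm v / 2)\<^sup>2 - (norm v / 2 - norm ?z)\<^sup>2"
    by (simp add: power2_eq_square algebra_simps)
  then have "(sqrt a * norm (approx a v))\<^sup>2 \<le> (norm v / 2)\<^sup>2"
    using assms by (simp add: power_mult_distrib) (smt (verit) zero_le_power2)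
  then have "sqrt a * norm (approx a v) \<le> norm v / 2" by (rule power2_le_imp_le) simp
  then show ?thesis using assms by (simp add: field_simps)
qed

text \<open>Since \<open>inner (A x) r = a * norm x\<^sup>2\<close> is nonnegative, \<open>norm r\<^sup>2 \<le> inner v r\<close>.\<close>

lemma residual_norm_le:
  assumes "a > 0"
  shows "norm (residual a v) \<le> norm v"
proof -
  let ?r = "residual a v"
  have "inner (v - ?r) ?r = inner (approx a v) (a *\<^sub>R approx a v)"
    by (rule adjD[OF approx_graph[OF assms] approx_adj[OF assms]])
  then have "inner (v - ?r) ?r \<ge> 0" using assms by simp
  then have "norm ?r * norm ?r \<le> inner v ?r"
    by (simp add: inner_diff_left power2_norm_eq_inner flip: power2_eq_square)
  also have "\<dots> \<le> norm v * norm ?r" by (rule norm_cauchy_schwarz)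
  finally show ?thesis by (cases "?r = 0") auto
qed

text \<open>
  On the domain of the adjoint, \<open>approx a\<close> solves \<open>(A\<^sup>* A + a) x = A\<^sup>* v\<close> literally; that domain is
  dense and \<open>approx a\<close> is continuous, so its graph is the closure.
\<close>

lemma reg_op_eq_approx_graph:
  assumes "a > 0"
  shows "reg_op inner A a = {(v, approx a v) | v. True}"
proof -
  let ?R = "adj O converse (shift_op (gram_op inner A) a)"
  let ?S = "{(v, approx a v) | v. True}"
  have cont: "continuous_on UNIV (approx a)"
  proof (rule lipschitz_on_continuous_on)
    show "lipschitz_on (1 / (2 * sqrt a)) UNIV (approx a)"
      using approx_norm_le[OF assms] assms
      by (intro lipschitz_onI) (simp_all add: dist_norm flip: approx_residual_diff(1)[OF assms])
  qed
  have "?R \<subseteq> ?S"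
  proof clarify
    fix v x w assume "(v, w) \<in> adj" "(x, w) \<in> shift_op (gram_op inner A) a"
    then obtain z q where "(x, z) \<in> A" "(z, q) \<in> adj" "w = q + a *\<^sub>R x"
      unfolding shift_op_def gram_op_def by blast
    then have "approx a v = x"
      using adj_diff[OF \<open>(v, w) \<in> adj\<close> \<open>(z, q) \<in> adj\<close>] by (intro approx_unique assms) simp_all
    then show "\<exists>v'. (v, x) = (v', approx a v') \<and> True" by blast
  qed
  moreover have "closed ?S"
  proof -
    have "?S = {p. snd p = approx a (fst p)}" by auto
    moreover have "closed {p :: 'a \<times> 'a. snd p = approx a (fst p)}"
      by (intro closed_Collect_eq continuous_intros continuous_on_compose2[OF cont]) auto
    ultimately show ?thesis by simp
  qed
  ultimately have "closure ?R \<subseteq> ?S" by (rule closure_minimal)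
  moreover have "?S \<subseteq> closure ?R"
  proof clarify
    fix v
    have "(v', approx a v') \<in> ?R" if v': "v' \<in> Domain adj" for v'
    proof -
      obtain w where w: "(v', w) \<in> adj" using v' by blast
      let ?z = "v' - residual a v'"
      have "(?z, w - a *\<^sub>R approx a v') \<in> adj"
        using adj_diff[OF w approx_adj[OF assms]] .
      then have "(approx a v', (w - a *\<^sub>R approx a v') + a *\<^sub>R approx a v')
          \<in> shift_op (gram_op inner A) a"
        using approx_graph[OF assms] unfolding shift_op_def gram_op_def by blast
      then show ?thesis using w by auto
    qed
    then have "(\<lambda>v. (v, approx a v)) ` Domain adj \<subseteq> ?R" by blast
    then have "closure ((\<lambda>v. (v, approx a v)) ` Domain adj) \<subseteq> closure ?R" by (rule closure_mono)
    moreover have "(\<lambda>v. (v, approx a v)) ` closure (Domain adj)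
        \<subseteq> closure ((\<lambda>v. (v, approx a v)) ` Domain adj)"
      by (intro image_closure_subset continuous_intros continuous_on_subset[OF cont] closure_subset
            closed_closure) auto
    ultimately show "(v, approx a v) \<in> closure ?R" by (auto simp: adj_domain_dense)
  qed
  ultimately show ?thesis unfolding reg_op_def by blast
qed

lemma op_app_reg_op: "a > 0 \<Longrightarrow> op_app (reg_op inner A a) v = approx a v"
  by (simp add: op_app_def reg_op_eq_approx_graph)

text \<open>
  The analogue of the resolvent identity: subtract the defining relations for \<open>a\<close> and \<open>b\<close>, and
  pair the differences with each other.
\<close>

lemma resolvent_identity:
  assumes "a > 0" and "b > 0"
  shows "(norm (residual a v - residual b v))\<^sup>2 + a * (norm (approx a v - approx b v))\<^sup>2
    = (b - a) * inner (approx b v) (approx a v - approx b v)"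
proof -
  have "(approx a v - approx b v, residual b v - residual a v) \<in> A"
    using graph_diff[OF approx_graph[OF assms(1), of v] approx_graph[OF assms(2), of v]] by simp
  moreover have "(residual a v - residual b v, a *\<^sub>R approx a v - b *\<^sub>R approx b v) \<in> adj"
    using approx_adj assms by (intro adj_diff)
  ultimately have "inner (residual b v - residual a v) (residual a v - residual b v)
    = inner (approx a v - approx b v) (a *\<^sub>R approx a v - b *\<^sub>R approx b v)" by (rule adjD)
  moreover have "residual b v - residual a v = - (residual a v - residual b v)" by simp
  moreover have "a *\<^sub>R approx a v - b *\<^sub>R approx b v
      = a *\<^sub>R (approx a v - approx b v) - (b - a) *\<^sub>R approx b v"
    by (simp add: algebra_simps)
  ultimately have "- inner (residual a v - residual b v) (residual a v - residual b v)
      = a * inner (approx a v - approx b v) (approx a v - approx b v)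
        - (b - a) * inner (approx a v - approx b v) (approx b v)"
    by (simp only: inner_minus_left inner_diff_right[of _ "_ *\<^sub>R _"] inner_scaleR_right)
  then show ?thesis
    unfolding power2_norm_eq_inner by (simp only: inner_commute[of "approx b v"])
qed

text \<open>
  For \<open>a < b\<close> and \<open>d = approx a v - approx b v\<close>, the resolvent identity gives
  \<open>inner (approx b v) d \<ge> 0\<close>; adding \<open>norm d\<^sup>2\<close> gives \<open>inner (approx a v) d \<ge> 0\<close>. The difference of the
  squared residual norms is a combination of these two with coefficients \<open>b\<close> and \<open>a\<close>.
\<close>

lemma residual_norm_mono:
  assumes "0 < a" and "a \<le> b"
  shows "norm (residual a v) \<le> norm (residual b v)"
proof (cases "a = b")
  case False
  then have ab: "a < b" "b > 0" using assms by auto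
  let ?d = "approx a v - approx b v"
  have "(b - a) * inner (approx b v) ?d \<ge> 0"
    using assms by (simp flip: resolvent_identity[OF assms(1) ab(2)])
  then have b: "inner (approx b v) ?d \<ge> 0" using ab by (simp add: zero_le_mult_iff)
  have "inner (approx a v) ?d = inner ?d ?d + inner (approx b v) ?d"
    by (simp add: inner_simps inner_commute)
  then have a: "inner (approx a v) ?d \<ge> 0" using b by simp
  have "(?d, residual b v - residual a v) \<in> A"
    using graph_diff[OF approx_graph[OF assms(1), of v] approx_graph[OF ab(2), of v]] by simp
  then have "inner (residual b v - residual a v) (residual a v) = a * inner (approx a v) ?d"
    "inner (residual b v - residual a v) (residual b v) = b * inner (approx b v) ?d"
    using adjD[OF _ approx_adj[OF assms(1)]] adjD[OF _ approx_adj[OF ab(2)]]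
    by (fastforce simp: inner_commute)+
  then have "(norm (residual b v))\<^sup>2 - (norm (residual a v))\<^sup>2
      = a * inner (approx a v) ?d + b * inner (approx b v) ?d"
    by (simp add: power2_norm_eq_inner inner_simps inner_commute)
  also have "\<dots> \<ge> 0" using a b assms ab by simp
  finally have "(norm (residual a v))\<^sup>2 \<le> (norm (residual b v))\<^sup>2" by simp
  then show ?thesis by (rule power2_le_imp_le) simp
qed simp

text \<open>
  The Cauchy-Schwarz inequality in the resolvent identity leaves a term linear in
  \<open>norm (approx a v - approx b v)\<close>; the quadratic term on the left absorbs it.
\<close>

lemma residual_continuous_on: "continuous_on {0<..} (\<lambda>a. residual a v)"
proof -
  have "((\<lambda>a. residual a v) \<longlongrightarrow> residual b v) (at b within {0<..})" if "b > 0" for b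
  proof -
    have "norm (residual a v - residual b v) \<le> \<bar>a - b\<bar> * norm (approx b v) / sqrt a"
      if "a > 0" for a
    proof -
      let ?d = "norm (approx a v - approx b v)"
      have "(norm (residual a v - residual b v))\<^sup>2 + a * ?d\<^sup>2
          \<le> \<bar>a - b\<bar> * norm (approx b v) * ?d"
      proof -
        have "(b - a) * inner (approx b v) (approx a v - approx b v)
            \<le> \<bar>b - a\<bar> * \<bar>inner (approx b v) (approx a v - approx b v)\<bar>"
          by (simp flip: abs_mult)
        also have "\<dots> \<le> \<bar>b - a\<bar> * (norm (approx b v) * ?d)"
          by (intro mult_left_mono Cauchy_Schwarz_ineq2) simp
        finally show ?thesis using resolvent_identity[OF \<open>a > 0\<close> \<open>b > 0\<close>, of v]
          by (simp add: abs_minus_commute mult.assoc)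
      qed
      moreover define K where "K = \<bar>a - b\<bar> * norm (approx b v)"
      moreover have "K\<^sup>2 / a - K * ?d + a * ?d\<^sup>2 = (K / sqrt a - sqrt a * ?d)\<^sup>2 + K * ?d"
        using \<open>a > 0\<close> by (simp add: power2_diff power_divide power_mult_distrib)
      moreover have "K * ?d \<ge> 0" by (simp add: K_def)
      ultimately have "(norm (residual a v - residual b v))\<^sup>2 \<le> K\<^sup>2 / a"
        using zero_le_power2[of "K / sqrt a - sqrt a * ?d"] by (smt (verit))
      also have "\<dots> = (K / sqrt a)\<^sup>2" using \<open>a > 0\<close> by (simp add: power_divide)
      finally show ?thesis
        unfolding K_def by (rule power2_le_imp_le) (use \<open>a > 0\<close> in simp)
    qed
    then have "\<forall>\<^sub>F a in at b within {0<..}.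
        norm (residual a v - residual b v) \<le> \<bar>a - b\<bar> * norm (approx b v) / sqrt a"
      by (auto simp: eventually_at_filter)
    moreover have "((\<lambda>a. \<bar>a - b\<bar> * norm (approx b v) / sqrt a)
        \<longlongrightarrow> \<bar>b - b\<bar> * norm (approx b v) / sqrt b) (at b within {0<..})"
      using \<open>b > 0\<close> by (intro tendsto_intros) auto
    ultimately have "((\<lambda>a. residual a v - residual b v) \<longlongrightarrow> 0) (at b within {0<..})"
      by - (erule Lim_null_comparison, simp)
    then show ?thesis by (rule LIM_zero_cancel)
  qed
  then show ?thesis by (simp add: continuous_on_def)
qed

lemma residual_eq_0_imp: "a > 0 \<Longrightarrow> residual a v = 0 \<Longrightarrow> v = 0"
  using approx_adj[of a v] approx_graph[of a v] adj_zero graph_zero by force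

section \<open>Exact data\<close>

text \<open>
  With the error \<open>e = y - approx a (A y)\<close> one has \<open>A e = residual a (A y)\<close> and
  \<open>A\<^sup>* (A e) = a (y - e)\<close>; pair the latter with \<open>e\<close>.
\<close>

lemma exact_data_identity:
  assumes "(y, f) \<in> A" and "a > 0"
  defines "e \<equiv> y - approx a f"
  shows "(norm e)\<^sup>2 + (norm (residual a f))\<^sup>2 / a = inner e y"
    and "(e, residual a f) \<in> A"
proof -
  show graph: "(e, residual a f) \<in> A"
    using graph_diff[OF assms(1) approx_graph[OF assms(2), of f]] by (simp add: e_def)
  have "inner (residual a f) (residual a f) = inner e (a *\<^sub>R (y - e))"
    using adjD[OF graph approx_adj[OF assms(2), of f]] by (simp add: e_def)
  then show "(norm e)\<^sup>2 + (norm (residual a f))\<^sup>2 / a = inner e y"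
    using assms(2) by (simp add: power2_norm_eq_inner inner_diff_right)
qed

lemma exact_error_le:
  assumes "(y, f) \<in> A" and "a > 0"
  shows "norm (y - approx a f) \<le> norm y"
    and "norm (residual a f) / sqrt a \<le> norm y"
proof -
  let ?e = "y - approx a f" and ?q = "norm (residual a f) / sqrt a"
  have id: "(norm ?e)\<^sup>2 + ?q\<^sup>2 \<le> norm ?e * norm y"
    using exact_data_identity(1)[OF assms] norm_cauchy_schwarz[of ?e y] assms(2)
    by (simp add: power_divide)
  then have "norm ?e * norm ?e \<le> norm ?e * norm y"
    using zero_le_power2[of ?q] unfolding power2_eq_square by linarith
  then show e: "norm ?e \<le> norm y" by (cases "?e = 0") auto
  have "?q\<^sup>2 \<le> norm ?e * norm y" using id by (smt (verit) zero_le_power2)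
  also have "\<dots> \<le> (norm y)\<^sup>2" unfolding power2_eq_square using e by (rule mult_right_mono) simp
  finally show "?q \<le> norm y" by (rule power2_le_imp_le) simp
qed

text \<open>
  Being orthogonal to the null space, \<open>y\<close> is approximated by some \<open>q = A\<^sup>* p\<close>. In
  \<open>inner e y = inner e (y - q) + inner (A e) p\<close> the first term is small with \<open>y - q\<close>, and the second one is at most \<open>sqrt a * norm y * norm p\<close>.
\<close>

lemma exact_error_tendsto_0:
  assumes yf: "(y, f) \<in> A" and orth: "\<And>n. n \<in> null_space A \<Longrightarrow> inner y n = 0"
  shows "((\<lambda>a. norm (y - approx a f)) \<longlongrightarrow> 0) (at_right 0)"
proof -
  have "((\<lambda>a. (norm (y - approx a f))\<^sup>2) \<longlongrightarrow> 0) (at_right 0)"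
  proof (rule tendstoI)
    fix \<epsilon> :: real assume "\<epsilon> > 0"
    define \<eta> where "\<eta> = \<epsilon> / (2 * (norm y + 1))"
    have "\<eta> > 0" using \<open>\<epsilon> > 0\<close> by (simp add: \<eta>_def add_nonneg_pos)
    then obtain p q where pq: "(p, q) \<in> adj" "dist q y < \<eta>"
      using orthogonal_null_space_imp_closure_range_adj[OF orth]
      by (auto simp: closure_approachable)
    have "norm y * \<eta> < (norm y + 1) * \<eta>" using \<open>\<eta> > 0\<close> by simp
    also have "\<dots> = \<epsilon> / 2" unfolding \<eta>_def
      using norm_ge_zero[of y] by (simp add: field_simps del: norm_ge_zero)
    finally have y\<eta>: "norm y * \<eta> < \<epsilon> / 2" .
    have bound: "(norm (y - approx a f))\<^sup>2 \<le> norm y * \<eta> + sqrt a * (norm y * norm p)"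
      if "a > 0" for a
    proof -
      let ?e = "y - approx a f" and ?r = "residual a f"
      have "(norm ?e)\<^sup>2 \<le> inner ?e y"
        using exact_data_identity(1)[OF yf that] that by (smt (verit) divide_nonneg_pos zero_le_power2)
      also have "\<dots> = inner ?e (y - q) + inner ?r p"
        using adjD[OF exact_data_identity(2)[OF yf that] pq(1)] by (simp add: inner_diff_right)
      also have "\<dots> \<le> norm ?e * norm (y - q) + norm ?r * norm p"
        by (intro add_mono norm_cauchy_schwarz)
      also have "\<dots> \<le> norm y * \<eta> + (sqrt a * norm y) * norm p"
        using exact_error_le[OF yf that] pq(2) that
        by (intro add_mono mult_mono) (auto simp: dist_norm norm_minus_commute field_simps)
      finally show ?thesis by (simp add: mult.assoc)
    qed
    have "((\<lambda>a. sqrt a * (norm y * norm p)) \<longlongrightarrow> sqrt 0 * (norm y * norm p)) (at_right 0)"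
      by (intro tendsto_intros)
    then have "\<forall>\<^sub>F a in at_right 0. sqrt a * (norm y * norm p) < \<epsilon> / 2"
      by (rule order_tendstoD(2)) (use \<open>\<epsilon> > 0\<close> in simp)
    then show "\<forall>\<^sub>F a in at_right 0. dist ((norm (y - approx a f))\<^sup>2) 0 < \<epsilon>"
      using eventually_at_right_less[of 0]
    proof eventually_elim
      case (elim a)
      then show ?case using bound[of a] y\<eta> by simp
    qed
  qed
  then have "((\<lambda>a. sqrt ((norm (y - approx a f))\<^sup>2)) \<longlongrightarrow> sqrt 0) (at_right 0)"
    by (rule tendsto_real_sqrt)
  then show ?thesis by simp
qed

text \<open>The scaled residual is controlled by the error, since its square is at most \<open>inner e y\<close>.\<close>

lemma exact_residual_tendsto_0:
  assumes yf: "(y, f) \<in> A" and orth: "\<And>n. n \<in> null_space A \<Longrightarrow> inner y n = 0"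
  shows "((\<lambda>a. norm (residual a f) / sqrt a) \<longlongrightarrow> 0) (at_right 0)"
proof -
  have "((\<lambda>a. sqrt (norm (y - approx a f) * norm y)) \<longlongrightarrow> sqrt (0 * norm y)) (at_right 0)"
    by (intro tendsto_intros exact_error_tendsto_0 assms)
  then have lim: "((\<lambda>a. sqrt (norm (y - approx a f) * norm y)) \<longlongrightarrow> 0) (at_right 0)" by simp
  have "\<forall>\<^sub>F a in at_right 0. norm (norm (residual a f) / sqrt a)
      \<le> sqrt (norm (y - approx a f) * norm y)"
    using eventually_at_right_less[of 0]
  proof eventually_elim
    case (elim a)
    have "(norm (residual a f) / sqrt a)\<^sup>2 \<le> norm (y - approx a f) * norm y"
      using exact_data_identity(1)[OF yf elim] norm_cauchy_schwarz[of "y - approx a f" y] elim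
      by (simp add: power_divide) (smt (verit) zero_le_power2)
    then show ?case using elim by (simp add: real_le_rsqrt)
  qed
  then show ?thesis using lim by (rule Lim_null_comparison)
qed

end

section \<open>The relaxation equation\<close>

text \<open>
  The function \<open>exp t * (u t - y)\<close> has derivative \<open>exp t * (w t - y)\<close>, whose norm is at most the
  derivative of \<open>G * exp t\<close>.
\<close>

lemma relaxation_bound:
  fixes u w :: "real \<Rightarrow> 'b::real_normed_vector"
  assumes ode: "\<And>t. t \<ge> 0 \<Longrightarrow> (u has_vector_derivative - u t + w t) (at t within {0..})"
    and st: "0 \<le> s" "s \<le> t"
    and bound: "\<And>\<tau>. s \<le> \<tau> \<Longrightarrow> \<tau> \<le> t \<Longrightarrow> norm (w \<tau> - y) \<le> G"
  shows "norm (u t - y) \<le> exp (s - t) * norm (u s - y) + G"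
proof (cases "s = t")
  case True
  have "G \<ge> 0" using bound[of s] st norm_ge_zero order_trans by blast
  then show ?thesis using True by simp
next
  case False
  define h where "h \<tau> = exp \<tau> *\<^sub>R (u \<tau> - y)" for \<tau>
  have h_deriv: "(h has_vector_derivative exp \<tau> *\<^sub>R (w \<tau> - y)) (at \<tau> within {0..})"
    if "\<tau> \<ge> 0" for \<tau>
  proof -
    have "(h has_vector_derivative exp \<tau> *\<^sub>R ((- u \<tau> + w \<tau>) - 0) + exp \<tau> *\<^sub>R (u \<tau> - y))
        (at \<tau> within {0..})"
      unfolding h_def
      by (intro derivative_intros ode that has_field_derivative_at_within[OF DERIV_exp])
    then show ?thesis by (simp add: algebra_simps)
  qed
  have "norm (h t - h s) \<le> G * exp t - G * exp s"
  proof (rule differentiable_bound_general[where f' = "\<lambda>\<tau>. exp \<tau> *\<^sub>R (w \<tau> - y)"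
        and \<phi>' = "\<lambda>\<tau>. G * exp \<tau>"])
    show "s < t" using False st by simp
    have "continuous_on {0..} h"
      by (rule continuous_on_vector_derivative[where f' = "\<lambda>\<tau>. exp \<tau> *\<^sub>R (w \<tau> - y)"])
        (simp add: h_deriv)
    then show "continuous_on {s..t} h" by (rule continuous_on_subset) (use st in auto)
    show "continuous_on {s..t} (\<lambda>t. G * exp t)" by (intro continuous_intros)
    fix \<tau> assume \<tau>: "s < \<tau>" "\<tau> < t"
    have "(at \<tau> within {0..}) = at \<tau>" using \<tau> st by (intro at_within_interior) simp
    then show "(h has_vector_derivative exp \<tau> *\<^sub>R (w \<tau> - y)) (at \<tau>)"
      using h_deriv[of \<tau>] \<tau> st by simp
    show "((\<lambda>t. G * exp t) has_vector_derivative G * exp \<tau>) (at \<tau>)"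
      by (auto intro!: derivative_eq_intros simp flip: has_real_derivative_iff_has_vector_derivative)
    show "norm (exp \<tau> *\<^sub>R (w \<tau> - y)) \<le> G * exp \<tau>"
      using bound[of \<tau>] \<tau> by simp
  qed
  moreover have "norm (h t) \<le> norm (h s) + norm (h t - h s)"
    by (metis add.commute norm_triangle_sub)
  moreover have "G * exp s \<ge> 0"
    using bound[of s] st norm_ge_zero[of "w s - y"] by (simp del: norm_ge_zero)
  ultimately have "exp t * norm (u t - y) \<le> exp s * norm (u s - y) + G * exp t"
    by (simp add: h_def)
  then have "exp t * norm (u t - y) \<le> exp t * (exp (s - t) * norm (u s - y) + G)"
    by (simp add: exp_diff algebra_simps)
  then show ?thesis by simp
qed

section \<open>The discrepancy principle\<close>

theorem theorem10:
  fixes scal :: "'k::real_or_complex_field \<Rightarrow> 'a::{real_inner, complete_space} \<Rightarrow> 'a"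
    and ip :: "'a \<Rightarrow> 'a \<Rightarrow> 'k"
    and A :: "('a \<times> 'a) set"
    and y f :: 'a
    and a a' a'' :: "real \<Rightarrow> real"
    and C :: real
    and f\<^sub>\<delta> :: "real \<Rightarrow> 'a"
    and u\<^sub>\<delta> :: "real \<Rightarrow> real \<Rightarrow> 'a"
  assumes "hilbert_space scal ip"
    and "linear_operator scal A" and "closed A" and "densely_defined A"
    and "y \<in> Domain A" and "f = op_app A y" and "\<And>v. v \<in> null_space A \<Longrightarrow> ip y v = 0"
    and "\<And>t. t \<ge> 0 \<Longrightarrow> a t > 0"
    and "antimono_on {0..} a"
    and "\<And>t. t \<ge> 0 \<Longrightarrow> (a has_real_derivative a' t) (at t within {0..})"
    and "\<And>t. t \<ge> 0 \<Longrightarrow> (a' has_real_derivative a'' t) (at t within {0..})"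
    and "continuous_on {0..} a''"
    and "((\<lambda>t. a t + \<bar>a' t\<bar> + a'' t) \<longlongrightarrow> 0) at_top"
    and "\<And>t. t \<ge> 0 \<Longrightarrow> a'' t > 0"
    and "((\<lambda>t. a' t / a t) \<longlongrightarrow> 0) at_top"
    and "1 < C" and "C < 2"
    and "\<forall>\<^sub>F \<delta> in at_right 0. norm (f\<^sub>\<delta> \<delta> - f) \<le> \<delta> \<and> norm (f\<^sub>\<delta> \<delta>) > C * \<delta>"
    and "\<forall>\<^sub>F \<delta> in at_right 0. u\<^sub>\<delta> \<delta> 0 = 0 \<and>
           (\<forall>t\<ge>0. (u\<^sub>\<delta> \<delta> has_vector_derivative
                      - u\<^sub>\<delta> \<delta> t + op_app (reg_op ip A (a t)) (f\<^sub>\<delta> \<delta>)) (at t within {0..}))"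
  shows "\<exists>t\<^sub>\<delta> :: real \<Rightarrow> real.
           (\<forall>\<^sub>F \<delta> in at_right 0. t\<^sub>\<delta> \<delta> \<ge> 0 \<and>
              norm (op_app A (op_app (reg_op ip A (a (t\<^sub>\<delta> \<delta>))) (f\<^sub>\<delta> \<delta>)) - f\<^sub>\<delta> \<delta>) = C * \<delta>) \<and>
           filterlim t\<^sub>\<delta> at_top (at_right 0) \<and>
           ((\<lambda>\<delta>. norm (u\<^sub>\<delta> \<delta> (t\<^sub>\<delta> \<delta>) - y)) \<longlongrightarrow> 0) (at_right 0)"
proof -
  interpret hilbert_space scal ip by fact
  interpret closed_dense_operator A
    using assms(2-4) linear_operator_imp_subspace
    by unfold_locales (auto simp: linear_operator_def densely_defined_def)
  note a_pos = assms(8)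
  have reg: "op_app (reg_op ip A (a t)) v = approx (a t) v" if "t \<ge> 0" for t v
  proof -
    have "reg_op ip A (a t) = reg_op inner A (a t)"
      by (simp add: reg_op_def gram_op_def adjoint_op_eq_real_adjoint[OF assms(2)])
    then show ?thesis using op_app_reg_op a_pos[OF that] by simp
  qed
  have disc: "norm (op_app A (op_app (reg_op ip A (a t)) v) - v) = norm (residual (a t) v)"
    if "t \<ge> 0" for t v
    using reg[OF that] by (simp add: residual_def norm_minus_commute)
  have yf: "(y, f) \<in> A" using assms(5,6) op_app_eq by auto
  have orth: "inner y n = 0" if "n \<in> null_space A" for n
    using assms(7)[OF that] by (rule ip_zero_imp_inner_zero)
  have a_lim: "(a \<longlongrightarrow> 0) at_top"
  proof (rule Lim_null_comparison[OF _ assms(13)])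
    show "\<forall>\<^sub>F t in at_top. norm (a t) \<le> a t + \<bar>a' t\<bar> + a'' t"
      using eventually_ge_at_top[of 0]
      by eventually_elim (use a_pos assms(14) in \<open>fastforce intro: add_nonneg_nonneg\<close>)
  qed
  have a_right: "filterlim a (at_right 0) at_top"
    unfolding filterlim_at using a_lim a_pos
    by (fastforce intro!: eventually_mono[OF eventually_ge_at_top[of 0]])
  have a_anti: "a t \<le> a s" if "0 \<le> s" "s \<le> t" for s t
    using assms(9) that by (auto simp: monotone_on_def)
  have a_cont: "continuous_on {0..} a"
    by (rule DERIV_continuous_on[where D = a']) (use assms(10) in auto)
  have noise: "norm (residual (a t) v - residual (a t) f) \<le> norm (v - f)" if "t \<ge> 0" for t v
    using residual_norm_le[OF a_pos[OF that], of "v - f"] approx_residual_diff(2)[OF a_pos[OF that]]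
    by simp

  have exact_pos: "norm (residual (a t) f) > 0" if "t \<ge> 0" for t
  proof -
    have "f \<noteq> 0"
    proof
      assume "f = 0"
      have "\<forall>\<^sub>F \<delta> in at_right (0::real). False"
        using assms(18) eventually_at_right_less[of 0]
      proof eventually_elim
        case (elim \<delta>)
        then have "norm (f\<^sub>\<delta> \<delta>) \<le> \<delta>" "C * \<delta> < norm (f\<^sub>\<delta> \<delta>)" using \<open>f = 0\<close> by simp_all
        moreover have "1 * \<delta> < C * \<delta>" using elim assms(16) by (intro mult_strict_right_mono) auto
        ultimately show ?case by linarith
      qed
      then show False by simp
    qed
    then show ?thesis using residual_eq_0_imp[OF a_pos[OF that]] by auto
  qed

  \<comment> \<open>Up to time \<open>M\<close> the discrepancy stays near that of the exact data, hence above \<open>C * \<delta>\<close>.\<close>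
  have early: "\<forall>\<^sub>F \<delta> in at_right 0. \<forall>t. 0 \<le> t \<and> t \<le> M \<longrightarrow> norm (residual (a t) (f\<^sub>\<delta> \<delta>)) > C * \<delta>"
    if "M \<ge> 0" for M
  proof -
    have "((\<lambda>\<delta>. (C + 1) * \<delta>) \<longlongrightarrow> (C + 1) * 0) (at_right 0)" by (intro tendsto_intros)
    then have "\<forall>\<^sub>F \<delta> in at_right 0. (C + 1) * \<delta> < norm (residual (a M) f)"
      by (rule order_tendstoD(2)) (use exact_pos[OF that] in simp)
    then show ?thesis using assms(18)
    proof eventually_elim
      case (elim \<delta>)
      have "norm (residual (a t) (f\<^sub>\<delta> \<delta>)) > C * \<delta>" if "0 \<le> t" "t \<le> M" for t
      proof -
        have "norm (residual (a M) f) \<le> norm (residual (a t) f)"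
          using a_pos a_anti that by (intro residual_norm_mono) auto
        moreover have "norm (residual (a t) f)
            \<le> norm (residual (a t) (f\<^sub>\<delta> \<delta>)) + norm (residual (a t) (f\<^sub>\<delta> \<delta>) - residual (a t) f)"
          by (metis norm_minus_commute norm_triangle_sub)
        ultimately show ?thesis
          using noise[OF that(1), of "f\<^sub>\<delta> \<delta>"] elim by (simp add: algebra_simps)
      qed
      then show ?case by blast
    qed
  qed

  have "\<forall>\<^sub>F \<delta> in at_right 0. \<exists>t\<ge>0. norm (residual (a t) (f\<^sub>\<delta> \<delta>)) = C * \<delta>"
    using early[of 0, simplified] assms(18) eventually_at_right_less[of 0]
  proof eventually_elim
    case (elim \<delta>)
    have "((\<lambda>t. norm (residual (a t) f) / sqrt (a t)) \<longlongrightarrow> 0) at_top"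
      using filterlim_compose[OF exact_residual_tendsto_0[OF yf orth] a_right] .
    then have "((\<lambda>t. norm (residual (a t) f) / sqrt (a t) * sqrt (a t)) \<longlongrightarrow> 0 * sqrt 0) at_top"
      by (intro tendsto_intros a_lim)
    then have "\<forall>\<^sub>F t in at_top. norm (residual (a t) f) / sqrt (a t) * sqrt (a t) < (C - 1) * \<delta>"
      by (rule order_tendstoD(2)) (use elim assms(16) in simp)
    then have "\<forall>\<^sub>F t in at_top. 0 \<le> t \<and>
        norm (residual (a t) f) / sqrt (a t) * sqrt (a t) < (C - 1) * \<delta>"
      by (intro eventually_conj eventually_ge_at_top)
    then obtain t where t: "t \<ge> 0"
        "norm (residual (a t) f) / sqrt (a t) * sqrt (a t) < (C - 1) * \<delta>"
      using eventually_happens[of _ "at_top :: real filter"] by auto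
    then have "norm (residual (a t) f) < (C - 1) * \<delta>" using a_pos[OF t(1)] by simp
    then have "norm (residual (a t) (f\<^sub>\<delta> \<delta>)) \<le> C * \<delta>"
      using noise[OF t(1), of "f\<^sub>\<delta> \<delta>"] elim
        norm_triangle_sub[of "residual (a t) (f\<^sub>\<delta> \<delta>)" "residual (a t) f"]
      by (simp add: algebra_simps)
    moreover have "continuous_on {0..t} (\<lambda>t. norm (residual (a t) (f\<^sub>\<delta> \<delta>)))"
      by (intro continuous_on_norm continuous_on_compose2[OF residual_continuous_on]
          continuous_on_subset[OF a_cont]) (use a_pos in auto)
    ultimately have "\<exists>s\<ge>0. s \<le> t \<and> norm (residual (a s) (f\<^sub>\<delta> \<delta>)) = C * \<delta>"
      using elim t(1) by (intro IVT2') auto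
    then show ?case by blast
  qed
  define t\<^sub>\<delta> where "t\<^sub>\<delta> \<delta> = (SOME t. t \<ge> 0 \<and> norm (residual (a t) (f\<^sub>\<delta> \<delta>)) = C * \<delta>)" for \<delta>
  have t_sol: "\<forall>\<^sub>F \<delta> in at_right 0. t\<^sub>\<delta> \<delta> \<ge> 0 \<and> norm (residual (a (t\<^sub>\<delta> \<delta>)) (f\<^sub>\<delta> \<delta>)) = C * \<delta>"
    using \<open>\<forall>\<^sub>F \<delta> in at_right 0. \<exists>t\<ge>0. norm (residual (a t) (f\<^sub>\<delta> \<delta>)) = C * \<delta>\<close>
    unfolding t\<^sub>\<delta>_def by eventually_elim (rule someI_ex, blast)

  have t_lim: "filterlim t\<^sub>\<delta> at_top (at_right 0)"
    unfolding filterlim_at_top_gt[where c = 0]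
  proof clarify
    fix M :: real assume "M > 0"
    show "\<forall>\<^sub>F \<delta> in at_right 0. M \<le> t\<^sub>\<delta> \<delta>"
      using early[OF less_imp_le[OF \<open>M > 0\<close>]] t_sol
    proof eventually_elim
      case (elim \<delta>)
      show ?case
      proof (rule ccontr)
        assume "\<not> M \<le> t\<^sub>\<delta> \<delta>"
        then have "0 \<le> t\<^sub>\<delta> \<delta> \<and> t\<^sub>\<delta> \<delta> \<le> M" using elim(2) by linarith
        then have "norm (residual (a (t\<^sub>\<delta> \<delta>)) (f\<^sub>\<delta> \<delta>)) > C * \<delta>" using elim(1) by blast
        then show False using elim(2) by linarith
      qed
    qed
  qed

  \<comment> \<open>The discrepancy equation forces \<open>(C - 1) * \<delta> \<le> norm (residual (a t) f)\<close>, which is \<open>o (sqrt (a t))\<close>.\<close>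
  have noise_lim: "((\<lambda>\<delta>. \<delta> / (2 * sqrt (a (t\<^sub>\<delta> \<delta>)))) \<longlongrightarrow> 0) (at_right 0)"
  proof (rule Lim_null_comparison)
    let ?q = "\<lambda>t. norm (residual (a t) f) / sqrt (a t)"
    have "((\<lambda>\<delta>. ?q (t\<^sub>\<delta> \<delta>)) \<longlongrightarrow> 0) (at_right 0)"
      by (rule filterlim_compose
          [OF filterlim_compose[OF exact_residual_tendsto_0[OF yf orth] a_right] t_lim])
    then show "((\<lambda>\<delta>. ?q (t\<^sub>\<delta> \<delta>) / (2 * (C - 1))) \<longlongrightarrow> 0) (at_right 0)"
      by (rule tendsto_divide_zero)
    show "\<forall>\<^sub>F \<delta> in at_right 0. norm (\<delta> / (2 * sqrt (a (t\<^sub>\<delta> \<delta>)))) \<le> ?q (t\<^sub>\<delta> \<delta>) / (2 * (C - 1))"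
      using t_sol assms(18) eventually_at_right_less[of 0]
    proof eventually_elim
      case (elim \<delta>)
      let ?a = "a (t\<^sub>\<delta> \<delta>)"
      have a: "?a > 0" using a_pos elim by blast
      have "C * \<delta> \<le> norm (residual ?a f) + \<delta>"
        using noise[of "t\<^sub>\<delta> \<delta>" "f\<^sub>\<delta> \<delta>"] elim
          norm_triangle_sub[of "residual ?a (f\<^sub>\<delta> \<delta>)" "residual ?a f"] by simp
      then have "\<delta> \<le> norm (residual ?a f) / (C - 1)"
        using assms(16) by (simp add: field_simps)
      then have "\<delta> / (2 * sqrt ?a) \<le> norm (residual ?a f) / (C - 1) / (2 * sqrt ?a)"
        using a by (intro divide_right_mono) simp_all
      then show ?case using elim a by (simp add: field_simps)
    qed
  qed

  have "((\<lambda>\<delta>. norm (u\<^sub>\<delta> \<delta> (t\<^sub>\<delta> \<delta>) - y)) \<longlongrightarrow> 0) (at_right 0)"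
  proof (rule tendstoI)
    fix \<epsilon> :: real assume "\<epsilon> > 0"
    have "((\<lambda>t. norm (y - approx (a t) f)) \<longlongrightarrow> 0) at_top"
      using filterlim_compose[OF exact_error_tendsto_0[OF yf orth] a_right] .
    then have "\<forall>\<^sub>F t in at_top. norm (y - approx (a t) f) < \<epsilon> / 3"
      by (rule order_tendstoD(2)) (use \<open>\<epsilon> > 0\<close> in simp)
    then obtain M0 where M0: "\<And>t. t \<ge> M0 \<Longrightarrow> norm (y - approx (a t) f) < \<epsilon> / 3"
      unfolding eventually_at_top_linorder by blast
    define M where "M = max 0 M0"
    have M: "M \<ge> 0" "\<And>t. t \<ge> M \<Longrightarrow> norm (y - approx (a t) f) < \<epsilon> / 3"
      using M0 by (auto simp: M_def)
    define K where "K = 2 * norm y + \<epsilon> / 3"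
    have "LIM \<delta> at_right 0. - t\<^sub>\<delta> \<delta> :> at_bot"
      using t_lim by (simp add: filterlim_uminus_at_top)
    then have "((\<lambda>\<delta>. exp (- t\<^sub>\<delta> \<delta>) * (exp M * K)) \<longlongrightarrow> 0) (at_right 0)"
      by (rule tendsto_mult_left_zero[OF filterlim_compose[OF exp_at_bot]])
    then have "\<forall>\<^sub>F \<delta> in at_right 0. exp (- t\<^sub>\<delta> \<delta>) * (exp M * K) < \<epsilon> / 3"
      by (rule order_tendstoD(2)) (use \<open>\<epsilon> > 0\<close> in simp)
    moreover have "\<forall>\<^sub>F \<delta> in at_right 0. \<delta> / (2 * sqrt (a (t\<^sub>\<delta> \<delta>))) < \<epsilon> / 3"
      using noise_lim by (rule order_tendstoD(2)) (use \<open>\<epsilon> > 0\<close> in simp)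
    moreover have "\<forall>\<^sub>F \<delta> in at_right 0. M \<le> t\<^sub>\<delta> \<delta>"
      using t_lim by (simp add: filterlim_at_top)
    ultimately show "\<forall>\<^sub>F \<delta> in at_right 0. dist (norm (u\<^sub>\<delta> \<delta> (t\<^sub>\<delta> \<delta>) - y)) 0 < \<epsilon>"
      using assms(18,19) eventually_at_right_less[of 0]
    proof eventually_elim
      case (elim \<delta>)
      let ?t = "t\<^sub>\<delta> \<delta>" and ?w = "\<lambda>t. approx (a t) (f\<^sub>\<delta> \<delta>)"
      have t: "?t \<ge> 0" using elim M(1) by linarith
      have ode: "(u\<^sub>\<delta> \<delta> has_vector_derivative - u\<^sub>\<delta> \<delta> t + ?w t) (at t within {0..})"
        if "t \<ge> 0" for t
        using elim that by (simp flip: reg)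
      have w: "norm (?w t - y) \<le> norm (y - approx (a t) f) + \<epsilon> / 3" if "0 \<le> t" "t \<le> ?t" for t
      proof -
        have "norm (?w t - approx (a t) f) \<le> norm (f\<^sub>\<delta> \<delta> - f) / (2 * sqrt (a t))"
          using approx_norm_le[OF a_pos[OF that(1)], of "f\<^sub>\<delta> \<delta> - f"]
          by (simp add: approx_residual_diff(1)[OF a_pos[OF that(1)]])
        \<comment> \<open>The bound \<open>\<delta> / (2 * sqrt (a t))\<close> on the effect of the noise is largest at the final time.\<close>
        also have "\<dots> \<le> \<delta> / (2 * sqrt (a ?t))"
          using elim a_anti[OF that] a_pos[OF t] by (intro frac_le) auto
        also have "\<dots> \<le> \<epsilon> / 3" using elim by simp
        finally have "norm (?w t - approx (a t) f) \<le> \<epsilon> / 3" .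
        moreover have "norm (?w t - y) \<le> norm (?w t - approx (a t) f) + norm (approx (a t) f - y)"
          using norm_triangle_ineq[of "?w t - approx (a t) f" "approx (a t) f - y"] by simp
        ultimately show ?thesis by (simp add: norm_minus_commute)
      qed
      have "norm (u\<^sub>\<delta> \<delta> M - y) \<le> exp (0 - M) * norm (u\<^sub>\<delta> \<delta> 0 - y) + (norm y + \<epsilon> / 3)"
      proof (rule relaxation_bound[OF ode])
        fix s assume s: "0 \<le> s" "s \<le> M"
        then show "norm (?w s - y) \<le> norm y + \<epsilon> / 3"
          using w[of s] exact_error_le(1)[OF yf a_pos[OF s(1)]] elim by linarith
      qed (use M(1) in auto)
      also have "\<dots> \<le> 1 * norm (u\<^sub>\<delta> \<delta> 0 - y) + (norm y + \<epsilon> / 3)"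
        using M(1) by (intro add_right_mono mult_right_mono) simp_all
      also have "\<dots> = K" using elim by (simp add: K_def)
      finally have uM: "norm (u\<^sub>\<delta> \<delta> M - y) \<le> K" .
      have "norm (u\<^sub>\<delta> \<delta> ?t - y) \<le> exp (M - ?t) * norm (u\<^sub>\<delta> \<delta> M - y) + (\<epsilon> / 3 + \<epsilon> / 3)"
      proof (rule relaxation_bound[OF ode])
        fix s assume s: "M \<le> s" "s \<le> ?t"
        then show "norm (?w s - y) \<le> \<epsilon> / 3 + \<epsilon> / 3"
          using w[of s] M(1) M(2)[of s] by linarith
      qed (use M(1) elim in auto)
      also have "\<dots> \<le> exp (M - ?t) * K + (\<epsilon> / 3 + \<epsilon> / 3)"
        using uM by (intro add_right_mono mult_left_mono) simp_all
      also have "exp (M - ?t) * K = exp (- ?t) * (exp M * K)"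
        by (simp add: exp_diff exp_minus field_simps)
      also have "\<dots> + (\<epsilon> / 3 + \<epsilon> / 3) < \<epsilon>" using elim by simp
      finally show ?case by simp
    qed
  qed
  moreover have "\<forall>\<^sub>F \<delta> in at_right 0. t\<^sub>\<delta> \<delta> \<ge> 0 \<and>
      norm (op_app A (op_app (reg_op ip A (a (t\<^sub>\<delta> \<delta>))) (f\<^sub>\<delta> \<delta>)) - f\<^sub>\<delta> \<delta>) = C * \<delta>"
    using t_sol by eventually_elim (simp add: disc)
  ultimately show ?thesis using t_lim by blast
qed

end
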